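(* Let $A, B, C$ be a right regular triple of semigroups such that $C$ is left commutative. If $A$ is left equalizer simple, then $C$ is left cancellative.
   Context: A semigroup is a nonempty set with an associative multiplication. For a semigroup $S$, a nonempty set $\Lambda$ and a mapping $P:\Lambda\to S$, let $\mathcal{M}(S;\Lambda;P)$ denote the semigroup on the set $S\times\Lambda$ with multiplication $(s,\lambda)(t,\mu)=(sP(\lambda)t,\mu)$. For a semigroup $S$, $\theta_S=\{(a,b)\in S\times S: xa=xb \text{ for all } x\in S\}$; this is a congruence on $S$. A triple $A,B,C$ of semigroups is called right regular if there exist mappings (not necessarily homomorphisms) $P:B\to A$ and $P':B\to C$ such that $\mathcal{M}(A;B;P)/\theta_{\mathcal{M}(A;B;P)}\cong\mathcal{M}(C;B;P')$ as semigroups. A semigroup is left commutative if it satisfies the identity $xya=yxa$. A semigroup $S$ is left equalizer simple if, for all $a,b\in S$, whenever $xa=xb$ holds for some $x\in S$, then $ya=yb$ holds for all $y\in S$. A semigroup $S$ is left cancellative if $xa=xb$ implies $a=b$ for all $x,a,b\in S$. *)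

theory Defs
  imports "HOL-Algebra.Group"
begin

(* Semigroups are represented by the record type of HOL-Algebra, so that hom, iso and
   is_iso can be used.  The field one of the record plays no role here: nothing is assumed
   about it, and it is left undefined in the constructions below. *)

locale carrier_semigroup =
  fixes S (structure)
  assumes carrier_nonempty: "carrier S \<noteq> {}"
    and mult_closed: "\<lbrakk>x \<in> carrier S; y \<in> carrier S\<rbrakk> \<Longrightarrow> x \<otimes> y \<in> carrier S"
    and mult_assoc: "\<lbrakk>x \<in> carrier S; y \<in> carrier S; z \<in> carrier S\<rbrakk>
      \<Longrightarrow> (x \<otimes> y) \<otimes> z = x \<otimes> (y \<otimes> z)"

definition sandwich :: "('a, 'm) monoid_scheme \<Rightarrow> 'l set \<Rightarrow> ('l \<Rightarrow> 'a) \<Rightarrow> ('a \<times> 'l) monoid"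
  where "sandwich S \<Lambda> P =
    \<lparr>carrier = carrier S \<times> \<Lambda>,
     mult = (\<lambda>(s, l) (t, m). (s \<otimes>\<^bsub>S\<^esub> P l \<otimes>\<^bsub>S\<^esub> t, m)),
     one = undefined\<rparr>"

definition theta :: "('a, 'm) monoid_scheme \<Rightarrow> ('a \<times> 'a) set"
  where "theta S = {(a, b) \<in> carrier S \<times> carrier S.
    \<forall>x\<in>carrier S. x \<otimes>\<^bsub>S\<^esub> a = x \<otimes>\<^bsub>S\<^esub> b}"

(* The product of two classes is the set of all elements related to a product of
   representatives; for a congruence r this is the class of any such product,
   see quotient_semigroup_mult_theta. *)
definition quotient_semigroup :: "('a, 'm) monoid_scheme \<Rightarrow> ('a \<times> 'a) set \<Rightarrow> 'a set monoid"
  where "quotient_semigroup S r =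
    \<lparr>carrier = carrier S // r,
     mult = (\<lambda>X Y. r `` {x \<otimes>\<^bsub>S\<^esub> y | x y. x \<in> X \<and> y \<in> Y}),
     one = undefined\<rparr>"

definition right_regular ::
    "('a, 'm) monoid_scheme \<Rightarrow> ('b, 'n) monoid_scheme \<Rightarrow> ('c, 'k) monoid_scheme \<Rightarrow> bool"
  where "right_regular A B C \<longleftrightarrow>
    (\<exists>P P'. P \<in> carrier B \<rightarrow> carrier A \<and> P' \<in> carrier B \<rightarrow> carrier C \<and>
      quotient_semigroup (sandwich A (carrier B) P) (theta (sandwich A (carrier B) P))
        \<cong> sandwich C (carrier B) P')"

definition left_commutative :: "('a, 'm) monoid_scheme \<Rightarrow> bool"
  where "left_commutative S \<longleftrightarrow>
    (\<forall>x\<in>carrier S. \<forall>y\<in>carrier S. \<forall>a\<in>carrier S.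
      x \<otimes>\<^bsub>S\<^esub> y \<otimes>\<^bsub>S\<^esub> a = y \<otimes>\<^bsub>S\<^esub> x \<otimes>\<^bsub>S\<^esub> a)"

definition left_equalizer_simple :: "('a, 'm) monoid_scheme \<Rightarrow> bool"
  where "left_equalizer_simple S \<longleftrightarrow>
    (\<forall>a\<in>carrier S. \<forall>b\<in>carrier S.
      (\<exists>x\<in>carrier S. x \<otimes>\<^bsub>S\<^esub> a = x \<otimes>\<^bsub>S\<^esub> b) \<longrightarrow>
      (\<forall>y\<in>carrier S. y \<otimes>\<^bsub>S\<^esub> a = y \<otimes>\<^bsub>S\<^esub> b))"

definition left_cancellative :: "('a, 'm) monoid_scheme \<Rightarrow> bool"
  where "left_cancellative S \<longleftrightarrow>
    (\<forall>x\<in>carrier S. \<forall>a\<in>carrier S. \<forall>b\<in>carrier S.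
      x \<otimes>\<^bsub>S\<^esub> a = x \<otimes>\<^bsub>S\<^esub> b \<longrightarrow> a = b)"

lemma carrier_semigroup_sandwich:
  assumes "carrier_semigroup S" and "\<Lambda> \<noteq> {}" and "P \<in> \<Lambda> \<rightarrow> carrier S"
  shows "carrier_semigroup (sandwich S \<Lambda> P)"
proof -
  interpret carrier_semigroup S by fact
  show ?thesis
    using assms(2,3) carrier_nonempty
    by unfold_locales (auto simp: sandwich_def mult_assoc mult_closed Pi_iff)
qed

context carrier_semigroup
begin

lemma equiv_theta: "equiv (carrier S) (theta S)"
  by (auto simp: equiv_def refl_on_def sym_def trans_def theta_def)

lemma theta_mult:
  assumes "(a, b) \<in> theta S" and "(c, d) \<in> theta S"
  shows "(a \<otimes> c, b \<otimes> d) \<in> theta S"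
proof -
  have m: "a \<in> carrier S" "b \<in> carrier S" "c \<in> carrier S" "d \<in> carrier S"
    and e: "\<And>x. x \<in> carrier S \<Longrightarrow> x \<otimes> a = x \<otimes> b" "\<And>x. x \<in> carrier S \<Longrightarrow> x \<otimes> c = x \<otimes> d"
    using assms by (auto simp: theta_def)
  have "x \<otimes> (a \<otimes> c) = x \<otimes> (b \<otimes> d)" if x: "x \<in> carrier S" for x
  proof -
    have "x \<otimes> (a \<otimes> c) = (x \<otimes> a) \<otimes> d"
      using e(2)[of "x \<otimes> a"] m x by (simp add: mult_assoc mult_closed)
    also have "\<dots> = x \<otimes> (b \<otimes> d)"
      using m x by (simp add: e(1) mult_assoc)
    finally show ?thesis .
  qed
  then show ?thesis using m by (simp add: theta_def mult_closed)
qed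

lemma quotient_semigroup_mult_theta:
  assumes "a \<in> carrier S" and "b \<in> carrier S"
  shows "theta S `` {a} \<otimes>\<^bsub>quotient_semigroup S (theta S)\<^esub> theta S `` {b} = theta S `` {a \<otimes> b}"
proof -
  have aa: "(a, a) \<in> theta S" and bb: "(b, b) \<in> theta S"
    using assms by (simp_all add: theta_def)
  have t: "trans (theta S)"
    using equiv_theta by (simp add: equiv_def)
  have "theta S `` {x \<otimes> y | x y. x \<in> theta S `` {a} \<and> y \<in> theta S `` {b}}
    = theta S `` {a \<otimes> b}" (is "?L = ?R")
  proof
    show "?L \<subseteq> ?R"
    proof
      fix z assume "z \<in> ?L"
      then obtain x y where "(a, x) \<in> theta S" "(b, y) \<in> theta S" "(x \<otimes> y, z) \<in> theta S"
        by blast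
      then have "(a \<otimes> b, z) \<in> theta S"
        using theta_mult transD[OF t] by meson
      then show "z \<in> ?R" by simp
    qed
    show "?R \<subseteq> ?L" using aa bb by blast
  qed
  then show ?thesis by (simp add: quotient_semigroup_def)
qed

end

end

theory Submission
  imports Defs
begin

text \<open>
  Left equalizer simplicity of \<open>A\<close> makes the quotient of \<open>\<M>(A;B;P)\<close> by \<open>\<theta>\<close> left cancellative,
  hence so is \<open>\<M>(C;B;P')\<close>: for all \<open>c\<close> and \<open>l\<close>, \<open>c P'(l) a = c P'(l) b\<close> implies \<open>a = b\<close>.
  If \<open>x a = x b\<close> in \<open>C\<close>, then left commutativity gives
  \<open>(x c) P'(l) a = c P'(l) x a = c P'(l) x b = (x c) P'(l) b\<close>, and therefore \<open>a = b\<close>.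
\<close>

text \<open>An equation in \<open>T\<close> pulls back along the bijection \<open>f\<close>;
  \<open>closed\<close> puts both products in \<open>carrier S\<close>, the only place where
  \<open>f\<close> is known to be injective.\<close>

lemma left_cancellative_is_iso:
  assumes iso: "S \<cong> T" and canc: "left_cancellative S"
    and closed: "\<And>x y. \<lbrakk>x \<in> carrier S; y \<in> carrier S\<rbrakk> \<Longrightarrow> x \<otimes>\<^bsub>S\<^esub> y \<in> carrier S"
  shows "left_cancellative T"
proof -
  obtain f where hom: "f \<in> hom S T" and inj: "inj_on f (carrier S)"
    and surj: "carrier T = f ` carrier S"
    using iso by (auto simp: is_iso_def iso_def bij_betw_def)
  have "a = b"
    if "x \<in> carrier S" "a \<in> carrier S" "b \<in> carrier S"
      and eq: "f x \<otimes>\<^bsub>T\<^esub> f a = f x \<otimes>\<^bsub>T\<^esub> f b" for x a b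
  proof -
    have "f (x \<otimes>\<^bsub>S\<^esub> a) = f (x \<otimes>\<^bsub>S\<^esub> b)"
      using eq that(1-3) by (simp add: hom_mult[OF hom])
    then have "x \<otimes>\<^bsub>S\<^esub> a = x \<otimes>\<^bsub>S\<^esub> b"
      using inj closed that(1-3) by (simp add: inj_on_eq_iff)
    then show ?thesis
      using canc that(1-3) by (simp add: left_cancellative_def)
  qed
  then show ?thesis
    unfolding left_cancellative_def surj by blast
qed

context carrier_semigroup
begin

lemma quotient_theta_closed:
  assumes "X \<in> carrier (quotient_semigroup S (theta S))"
    and "Y \<in> carrier (quotient_semigroup S (theta S))"
  shows "X \<otimes>\<^bsub>quotient_semigroup S (theta S)\<^esub> Y \<in> carrier (quotient_semigroup S (theta S))"
proof -
  obtain a b where ab: "a \<in> carrier S" "b \<in> carrier S"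
    and XY: "X = theta S `` {a}" "Y = theta S `` {b}"
    using assms by (auto simp: quotient_semigroup_def elim!: quotientE)
  have "theta S `` {a \<otimes> b} \<in> carrier (quotient_semigroup S (theta S))"
    using ab by (simp add: quotient_semigroup_def quotientI mult_closed)
  then show ?thesis
    unfolding XY quotient_semigroup_mult_theta[OF ab] .
qed

text \<open>Classes multiply through representatives, so cancelling in the quotient amounts to
  cancelling in \<open>S\<close> modulo \<open>theta S\<close>.\<close>

lemma left_cancellative_quotient_theta:
  assumes canc: "\<And>x a b. \<lbrakk>x \<in> carrier S; a \<in> carrier S; b \<in> carrier S;
      (x \<otimes> a, x \<otimes> b) \<in> theta S\<rbrakk> \<Longrightarrow> (a, b) \<in> theta S"
  shows "left_cancellative (quotient_semigroup S (theta S))"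
  unfolding left_cancellative_def
proof (intro ballI impI)
  fix X Y Z
  assume "X \<in> carrier (quotient_semigroup S (theta S))"
    and "Y \<in> carrier (quotient_semigroup S (theta S))"
    and "Z \<in> carrier (quotient_semigroup S (theta S))"
    and eq: "X \<otimes>\<^bsub>quotient_semigroup S (theta S)\<^esub> Y = X \<otimes>\<^bsub>quotient_semigroup S (theta S)\<^esub> Z"
  then obtain x a b where x: "x \<in> carrier S" and a: "a \<in> carrier S" and b: "b \<in> carrier S"
    and XYZ: "X = theta S `` {x}" "Y = theta S `` {a}" "Z = theta S `` {b}"
    unfolding quotient_semigroup_def partial_object.simps by (elim quotientE)
  have "theta S `` {x \<otimes> a} = theta S `` {x \<otimes> b}"
    using eq x a b by (simp add: XYZ quotient_semigroup_mult_theta)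
  then have "(x \<otimes> a, x \<otimes> b) \<in> theta S"
    by (rule eq_equiv_class[OF _ equiv_theta mult_closed[OF x b]])
  then show "Y = Z"
    unfolding XYZ by (rule equiv_class_eq[OF equiv_theta canc[OF x a b]])
qed

text \<open>Equality modulo \<open>theta\<close> yields genuine equality after one more left
  multiplication. Its second coordinates give equal indices, its first a single equation in
  \<open>S\<close>, which left equalizer simplicity spreads to all left factors.\<close>

lemma theta_sandwich_cancel:
  assumes les: "left_equalizer_simple S" and P: "P \<in> \<Lambda> \<rightarrow> carrier S"
    and xab: "x \<in> carrier (sandwich S \<Lambda> P)" "a \<in> carrier (sandwich S \<Lambda> P)"
      "b \<in> carrier (sandwich S \<Lambda> P)"
    and th: "(x \<otimes>\<^bsub>sandwich S \<Lambda> P\<^esub> a, x \<otimes>\<^bsub>sandwich S \<Lambda> P\<^esub> b) \<in> theta (sandwich S \<Lambda> P)"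
  shows "(a, b) \<in> theta (sandwich S \<Lambda> P)"
proof -
  obtain x1 l a1 m b1 n where dec: "x = (x1, l)" "a = (a1, m)" "b = (b1, n)"
    and mem: "x1 \<in> carrier S" "l \<in> \<Lambda>" "a1 \<in> carrier S" "m \<in> \<Lambda>" "b1 \<in> carrier S" "n \<in> \<Lambda>"
    using xab by (auto simp: sandwich_def)
  have Pl: "P k \<in> carrier S" if "k \<in> \<Lambda>" for k
    using P that by auto
  \<comment> \<open>This is the left factor of \<open>a1\<close> in the first coordinate of
    \<open>x\<close> times \<open>x\<close> times \<open>a\<close>.\<close>
  define z where "z = x1 \<otimes> P l \<otimes> (x1 \<otimes> P l)"
  have z: "z \<in> carrier S"
    using mem by (simp add: z_def mult_closed Pl)
  \<comment> \<open>Among the multipliers that \<open>theta\<close> allows, \<open>x\<close> itself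
    is at hand.\<close>
  have "x \<otimes>\<^bsub>sandwich S \<Lambda> P\<^esub> (x \<otimes>\<^bsub>sandwich S \<Lambda> P\<^esub> a)
      = x \<otimes>\<^bsub>sandwich S \<Lambda> P\<^esub> (x \<otimes>\<^bsub>sandwich S \<Lambda> P\<^esub> b)"
    using th xab(1) by (auto simp: theta_def)
  then have "z \<otimes> a1 = z \<otimes> b1" and "m = n"
    using mem by (simp_all add: dec z_def sandwich_def mult_assoc mult_closed Pl)
  \<comment> \<open>Left multiplication by \<open>(s, k)\<close> in the sandwich acts on the first
    coordinate as \<open>y = s \<otimes> P k\<close>.\<close>
  then have "y \<otimes> a1 = y \<otimes> b1" if "y \<in> carrier S" for y
    using les z mem(3,5) that unfolding left_equalizer_simple_def by blast
  with \<open>m = n\<close> show ?thesis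
    using mem by (simp add: theta_def dec sandwich_def mult_closed Pl split_paired_all)
qed

text \<open>The sandwich only cancels factors ending in some \<open>P l\<close>; left commutativity
  brings a given left factor into that form.\<close>

lemma left_cancellative_of_sandwich:
  assumes lc: "left_commutative S" and P: "P \<in> \<Lambda> \<rightarrow> carrier S" and "\<Lambda> \<noteq> {}"
    and canc: "left_cancellative (sandwich S \<Lambda> P)"
  shows "left_cancellative S"
  unfolding left_cancellative_def
proof (intro ballI impI)
  fix x a b
  assume x: "x \<in> carrier S" and a: "a \<in> carrier S" and b: "b \<in> carrier S"
    and eq: "x \<otimes> a = x \<otimes> b"
  obtain l where l: "l \<in> \<Lambda>" using \<open>\<Lambda> \<noteq> {}\<close> by blast
  have p: "P l \<in> carrier S" using P l by auto
  \<comment> \<open>The auxiliary factor \<open>c\<close> of the idea is taken to be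
    \<open>x\<close>; left commutativity exchanges \<open>x\<close> and
    \<open>x \<otimes> P l\<close>.\<close>
  have swap: "x \<otimes> x \<otimes> P l \<otimes> d = x \<otimes> P l \<otimes> (x \<otimes> d)" if d: "d \<in> carrier S" for d
  proof -
    have "x \<otimes> (x \<otimes> P l) \<otimes> d = (x \<otimes> P l) \<otimes> x \<otimes> d"
      using lc x p d by (simp add: left_commutative_def mult_closed)
    then show ?thesis
      using x p d by (simp add: mult_assoc mult_closed)
  qed
  \<comment> \<open>Using one index \<open>l\<close> throughout makes the second coordinates
    agree.\<close>
  have "(x \<otimes> x, l) \<otimes>\<^bsub>sandwich S \<Lambda> P\<^esub> (a, l) = (x \<otimes> x, l) \<otimes>\<^bsub>sandwich S \<Lambda> P\<^esub> (b, l)"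
    using a b by (simp add: sandwich_def swap eq)
  moreover have "(d, l) \<in> carrier (sandwich S \<Lambda> P)" if "d \<in> carrier S" for d
    using that l by (simp add: sandwich_def)
  ultimately have "(a, l) = (b, l)"
    using canc x a b mult_closed unfolding left_cancellative_def by blast
  then show "a = b" by simp
qed

end

theorem theorem5:
  fixes A :: "('a, 'm) monoid_scheme"
    and B :: "('b, 'n) monoid_scheme"
    and C :: "('c, 'k) monoid_scheme"
  assumes "carrier_semigroup A" and "carrier_semigroup B" and "carrier_semigroup C"
    and "right_regular A B C"
    and "left_commutative C"
    and "left_equalizer_simple A"
  shows "left_cancellative C"
proof -
  \<comment> \<open>A nonempty index set makes the sandwich over \<open>A\<close> a semigroup and
    later provides an index in the sandwich over \<open>C\<close>.\<close>
  have B: "carrier B \<noteq> {}"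
    using assms(2) by (rule carrier_semigroup.carrier_nonempty)
  obtain P P' where P: "P \<in> carrier B \<rightarrow> carrier A" and P': "P' \<in> carrier B \<rightarrow> carrier C"
    and iso: "quotient_semigroup (sandwich A (carrier B) P) (theta (sandwich A (carrier B) P))
      \<cong> sandwich C (carrier B) P'"
    using assms(4) by (auto simp: right_regular_def)
  interpret M: carrier_semigroup "sandwich A (carrier B) P"
    using assms(1) B P by (rule carrier_semigroup_sandwich)
  have "left_cancellative
      (quotient_semigroup (sandwich A (carrier B) P) (theta (sandwich A (carrier B) P)))"
    using carrier_semigroup.theta_sandwich_cancel[OF assms(1,6) P]
    by (rule M.left_cancellative_quotient_theta)
  with iso have "left_cancellative (sandwich C (carrier B) P')"
    by (rule left_cancellative_is_iso) (rule M.quotient_theta_closed)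
  then show ?thesis
    by (rule carrier_semigroup.left_cancellative_of_sandwich[OF assms(3,5) P' B])
qed

end
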